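(* Let $\mu$ be a positive measure such that $L_1(\mu)$ is a dual space, and let $B$ be a Banach space (i.e. a closed linear subspace of $L_1(\mu)$) consisting of SSD-points of $L_1(\mu)$. Then $B$ is finite dimensional.
   Context: All Banach spaces are over $\mathbb{R}$. "$L_1(\mu)$ is a dual space" means that it is isometric to $X^*$ for some Banach space $X$. $B_X$ denotes the closed unit ball of $X$. A vector $x$ in a Banach space $X$ is an SSD-point (point of strong subdifferentiability) of $X$ if the one-sided limit $\lim_{t\to 0^+}\frac{\|x+th\|-\|x\|}{t}$ exists uniformly for $h\in B_X$. "$B$ consists of SSD-points of $L_1(\mu)$" means that every element of $B$ is an SSD-point of $L_1(\mu)$. *)

theory Defs
  imports "HOL-Analysis.Analysis"
begin

text \<open>
  The space of integrable functions modulo equality almost everywhere depends on the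
  measure, hence cannot be a type. Normed spaces are therefore given by explicit operations on
  a carrier set; the operations are only meaningful on the carrier.
\<close>

record 'v normed_sp =
  vcarrier :: "'v set"
  vzero :: 'v
  vadd :: "'v \<Rightarrow> 'v \<Rightarrow> 'v"
  vscale :: "real \<Rightarrow> 'v \<Rightarrow> 'v"
  vnorm :: "'v \<Rightarrow> real"

definition unit_ball :: "'v normed_sp \<Rightarrow> 'v set" where
  "unit_ball V = {h \<in> vcarrier V. vnorm V h \<le> 1}"

text \<open>
  The value 0 off the carrier is there because the library's \<open>Metric_space\<close> asks for
  non-negativity and symmetry on the whole type.
\<close>

definition norm_dist :: "'v normed_sp \<Rightarrow> 'v \<Rightarrow> 'v \<Rightarrow> real" where
  "norm_dist V x y =
     (if x \<in> vcarrier V \<and> y \<in> vcarrier V then vnorm V (vadd V x (vscale V (-1) y)) else 0)"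

definition norm_topology :: "'v normed_sp \<Rightarrow> 'v topology" where
  "norm_topology V = Metric_space.mtopology (vcarrier V) (norm_dist V)"

definition linear_subspace :: "'v normed_sp \<Rightarrow> 'v set \<Rightarrow> bool" where
  "linear_subspace V S \<longleftrightarrow>
     S \<subseteq> vcarrier V \<and> vzero V \<in> S \<and>
     (\<forall>x\<in>S. \<forall>y\<in>S. vadd V x y \<in> S) \<and>
     (\<forall>c. \<forall>x\<in>S. vscale V c x \<in> S)"

definition closed_linear_subspace :: "'v normed_sp \<Rightarrow> 'v set \<Rightarrow> bool" where
  "closed_linear_subspace V S \<longleftrightarrow> linear_subspace V S \<and> closedin (norm_topology V) S"

definition finite_dimensional :: "'v normed_sp \<Rightarrow> 'v set \<Rightarrow> bool" where
  "finite_dimensional V S \<longleftrightarrow> (\<exists>F. finite F \<and> F \<subseteq> S \<and> linear_subspace V hull F = S)"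

definition SSD_point :: "'v normed_sp \<Rightarrow> 'v \<Rightarrow> bool" where
  "SSD_point V x \<longleftrightarrow> x \<in> vcarrier V \<and>
     (\<exists>l. uniform_limit (unit_ball V)
            (\<lambda>t h. (vnorm V (vadd V x (vscale V t h)) - vnorm V x) / t) l (at_right 0))"

definition linear_isometry_onto :: "'v normed_sp \<Rightarrow> ('v \<Rightarrow> 'b::real_normed_vector) \<Rightarrow> bool" where
  "linear_isometry_onto V T \<longleftrightarrow>
     bij_betw T (vcarrier V) UNIV \<and>
     (\<forall>x\<in>vcarrier V. \<forall>y\<in>vcarrier V. T (vadd V x y) = T x + T y) \<and>
     (\<forall>c. \<forall>x\<in>vcarrier V. T (vscale V c x) = c *\<^sub>R T x) \<and>
     (\<forall>x\<in>vcarrier V. norm (T x) = vnorm V x)"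

text \<open>
  HOL has no quantifier over types, so the predual appears as a type argument. A theorem
  assuming \<open>isometric_to_dual V TYPE('x)\<close> with \<open>'x\<close> free holds for every predual, which is
  the same as assuming that some predual exists.
\<close>

definition isometric_to_dual :: "'v normed_sp \<Rightarrow> 'x::banach itself \<Rightarrow> bool" where
  "isometric_to_dual V (_ :: 'x itself) \<longleftrightarrow>
     (\<exists>T :: 'v \<Rightarrow> ('x \<Rightarrow>\<^sub>L real). linear_isometry_onto V T)"

definition ae_rel :: "'a measure \<Rightarrow> (('a \<Rightarrow> real) \<times> ('a \<Rightarrow> real)) set" where
  "ae_rel M = {(f, g). integrable M f \<and> integrable M g \<and> (AE x in M. f x = g x)}"

text \<open>
  The operations on classes are those on representatives; that they do not depend on the
  choice is recorded in the lemmas below.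
\<close>

definition L1 :: "'a measure \<Rightarrow> ('a \<Rightarrow> real) set normed_sp" where
  "L1 M = \<lparr>
     vcarrier = {f. integrable M f} // ae_rel M,
     vzero = ae_rel M `` {\<lambda>x. 0},
     vadd = (\<lambda>X Y. \<Union>f\<in>X. \<Union>g\<in>Y. ae_rel M `` {\<lambda>x. f x + g x}),
     vscale = (\<lambda>c X. \<Union>f\<in>X. ae_rel M `` {\<lambda>x. c * f x}),
     vnorm = (\<lambda>X. the_elem ((\<lambda>f. \<integral>x. \<bar>f x\<bar> \<partial>M) ` X))\<rparr>"

lemma equiv_ae_rel: "equiv {f. integrable M f} (ae_rel M)"
proof (rule equivI)
  show "ae_rel M \<subseteq> {f. integrable M f} \<times> {f. integrable M f}" by (auto simp: ae_rel_def)
  show "refl_on {f. integrable M f} (ae_rel M)" by (auto simp: refl_on_def ae_rel_def)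
  show "sym (ae_rel M)" by (auto simp: sym_def ae_rel_def)
  show "trans (ae_rel M)"
  proof (rule transI)
    fix f g h assume "(f, g) \<in> ae_rel M" "(g, h) \<in> ae_rel M"
    moreover have "AE x in M. f x = h x"
      if "AE x in M. f x = g x" "AE x in M. g x = h x"
      using that by eventually_elim simp
    ultimately show "(f, h) \<in> ae_rel M" by (auto simp: ae_rel_def)
  qed
qed

lemma L1_vcarrier: "vcarrier (L1 M) = (\<lambda>f. ae_rel M `` {f}) ` {f. integrable M f}"
  by (auto simp: L1_def quotient_def)

lemma L1_vadd:
  assumes "integrable M f" "integrable M g"
  shows "vadd (L1 M) (ae_rel M `` {f}) (ae_rel M `` {g}) = ae_rel M `` {\<lambda>x. f x + g x}"
proof -
  have "congruent2 (ae_rel M) (ae_rel M) (\<lambda>f g. ae_rel M `` {\<lambda>x. f x + g x})"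
  proof (rule congruent2I')
    fix f f' g g' assume "(f, f') \<in> ae_rel M" "(g, g') \<in> ae_rel M"
    then have "(\<lambda>x. f x + g x, \<lambda>x. f' x + g' x) \<in> ae_rel M"
      unfolding ae_rel_def by auto
    then show "ae_rel M `` {\<lambda>x. f x + g x} = ae_rel M `` {\<lambda>x. f' x + g' x}"
      by (rule equiv_class_eq[OF equiv_ae_rel])
  qed
  from UN_equiv_class2[OF equiv_ae_rel equiv_ae_rel this] assms show ?thesis
    by (simp add: L1_def)
qed

lemma L1_vscale:
  assumes "integrable M f"
  shows "vscale (L1 M) c (ae_rel M `` {f}) = ae_rel M `` {\<lambda>x. c * f x}"
proof -
  have "congruent (ae_rel M) (\<lambda>f. ae_rel M `` {\<lambda>x. c * f x})"
  proof (rule congruentI)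
    fix f g assume "(f, g) \<in> ae_rel M"
    then have "(\<lambda>x. c * f x, \<lambda>x. c * g x) \<in> ae_rel M"
      unfolding ae_rel_def by auto
    then show "ae_rel M `` {\<lambda>x. c * f x} = ae_rel M `` {\<lambda>x. c * g x}"
      by (rule equiv_class_eq[OF equiv_ae_rel])
  qed
  from UN_equiv_class[OF equiv_ae_rel this] assms show ?thesis
    by (simp add: L1_def)
qed

lemma L1_vnorm:
  assumes "integrable M f"
  shows "vnorm (L1 M) (ae_rel M `` {f}) = (\<integral>x. \<bar>f x\<bar> \<partial>M)"
proof -
  have eq: "(\<integral>x. \<bar>g x\<bar> \<partial>M) = (\<integral>x. \<bar>f x\<bar> \<partial>M)" if "g \<in> ae_rel M `` {f}" for g
    using that unfolding ae_rel_def by (intro integral_cong_AE) auto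
  have "f \<in> ae_rel M `` {f}" using assms by (auto simp: ae_rel_def)
  then have "ae_rel M `` {f} \<noteq> {}" by blast
  then have "(\<lambda>f. \<integral>x. \<bar>f x\<bar> \<partial>M) ` (ae_rel M `` {f}) = {\<integral>x. \<bar>f x\<bar> \<partial>M}"
    by (simp only: image_cong[OF refl eq] image_constant_conv if_False)
  then show ?thesis by (simp add: L1_def)
qed

lemma norm_dist_L1:
  assumes "integrable M f" "integrable M g"
  shows "norm_dist (L1 M) (ae_rel M `` {f}) (ae_rel M `` {g}) = (\<integral>x. \<bar>f x - g x\<bar> \<partial>M)"
  using assms by (auto simp: norm_dist_def L1_vcarrier L1_vscale L1_vadd L1_vnorm)

lemma Metric_space_L1: "Metric_space (vcarrier (L1 M)) (norm_dist (L1 M))"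
proof
  fix X Y
  show "0 \<le> norm_dist (L1 M) X Y"
  proof (cases "X \<in> vcarrier (L1 M) \<and> Y \<in> vcarrier (L1 M)")
    case True
    then show ?thesis by (auto simp: L1_vcarrier norm_dist_L1)
  qed (auto simp: norm_dist_def)
  show "norm_dist (L1 M) X Y = norm_dist (L1 M) Y X"
  proof (cases "X \<in> vcarrier (L1 M) \<and> Y \<in> vcarrier (L1 M)")
    case True
    then show ?thesis by (auto simp: L1_vcarrier norm_dist_L1 abs_minus_commute)
  qed (auto simp: norm_dist_def)
next
  fix X Y assume "X \<in> vcarrier (L1 M)" "Y \<in> vcarrier (L1 M)"
  then obtain f g where f: "integrable M f" "X = ae_rel M `` {f}"
    and g: "integrable M g" "Y = ae_rel M `` {g}" by (auto simp: L1_vcarrier)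
  have "norm_dist (L1 M) X Y = 0 \<longleftrightarrow> (\<integral>x. \<bar>f x - g x\<bar> \<partial>M) = 0"
    using f g by (simp add: norm_dist_L1)
  also have "\<dots> \<longleftrightarrow> (AE x in M. \<bar>f x - g x\<bar> = 0)"
    using f g by (intro integral_nonneg_eq_0_iff_AE) auto
  also have "\<dots> \<longleftrightarrow> (f, g) \<in> ae_rel M"
    using f g by (simp add: ae_rel_def)
  also have "\<dots> \<longleftrightarrow> X = Y"
    using f g equiv_class_eq_iff[OF equiv_ae_rel, of f g M] by auto
  finally show "norm_dist (L1 M) X Y = 0 \<longleftrightarrow> X = Y" .
next
  fix X Y Z assume "X \<in> vcarrier (L1 M)" "Y \<in> vcarrier (L1 M)" "Z \<in> vcarrier (L1 M)"
  then obtain f g h where f: "integrable M f" "X = ae_rel M `` {f}"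
    and g: "integrable M g" "Y = ae_rel M `` {g}"
    and h: "integrable M h" "Z = ae_rel M `` {h}" by (auto simp: L1_vcarrier)
  have "(\<integral>x. \<bar>f x - h x\<bar> \<partial>M) \<le> (\<integral>x. \<bar>f x - g x\<bar> + \<bar>g x - h x\<bar> \<partial>M)"
    using f g h by (intro integral_mono) auto
  also have "\<dots> = (\<integral>x. \<bar>f x - g x\<bar> \<partial>M) + (\<integral>x. \<bar>g x - h x\<bar> \<partial>M)"
    using f g h by (intro Bochner_Integration.integral_add) auto
  finally show "norm_dist (L1 M) X Z \<le> norm_dist (L1 M) X Y + norm_dist (L1 M) Y Z"
    using f g h by (simp add: norm_dist_L1)
qed

end

theory Submission
  imports Defs
begin

text \<open>
  Suppose \<open>f\<close> is an SSD-point and \<open>E\<close> carries mass \<open>J = \<integral>\<^sub>E \<bar>f\<bar> > 0\<close>. Moving from \<open>f\<close> in the unit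
  direction \<open>- f 1\<^sub>E / J\<close>, the difference quotient of the norm is \<open>-1\<close> at \<open>t = J\<close> and \<open>1/2\<close> at
  \<open>t = 4 J\<close>. Uniformity in the direction therefore bounds \<open>J\<close> away from 0, so only finitely many
  disjoint sets can carry mass of \<open>f\<close>.

  Carrying mass on \<open>n\<close> disjoint sets is an open condition. If \<open>B\<close> is infinite dimensional it is also
  dense in \<open>B\<close>: let \<open>n\<close> be the largest number of sets for \<open>g\<close>. If every element of \<open>B\<close> vanished
  where \<open>g\<close> does, then the integrals over \<open>n\<close> such sets would determine it; hence some
  \<open>h \<in> B\<close> does not vanish there, and \<open>g + t h\<close> carries mass on \<open>n + 1\<close> sets for all small \<open>t > 0\<close>.
  By the Baire category theorem some element of \<open>B\<close> carries mass on arbitrarily many disjoint sets.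
\<close>

section \<open>Classes of integrable functions and completeness of \<open>L1 M\<close>\<close>

abbreviation L1_class :: "'a measure \<Rightarrow> ('a \<Rightarrow> real) \<Rightarrow> ('a \<Rightarrow> real) set" where
  "L1_class M f \<equiv> ae_rel M `` {f}"

lemma L1_class_eq_iff:
  assumes "integrable M f" "integrable M g"
  shows "L1_class M f = L1_class M g \<longleftrightarrow> (AE x in M. f x = g x)"
  using eq_equiv_class_iff[OF equiv_ae_rel[of M], of f g] assms by (auto simp: ae_rel_def)

lemma L1_vzero: "vzero (L1 M) = L1_class M (\<lambda>x. 0)"
  by (simp add: L1_def)

text \<open>The limit is the pointwise limit of a subsequence that is Cauchy almost everywhere;
  Fatou's lemma along that subsequence turns the Cauchy estimate into an estimate against
  \<open>f\<close>.\<close>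

lemma L1_limit_exists:
  fixes s :: "nat \<Rightarrow> 'a \<Rightarrow> real"
  assumes s: "\<And>n. integrable M (s n)"
    and cauchy: "\<And>e. e > 0 \<Longrightarrow> \<exists>N. \<forall>i\<ge>N. \<forall>j\<ge>N. (\<integral>x. \<bar>s i x - s j x\<bar> \<partial>M) < e"
  obtains f where "integrable M f" "(\<lambda>n. \<integral>x. \<bar>s n x - f x\<bar> \<partial>M) \<longlonglongrightarrow> 0"
proof -
  obtain r where r: "strict_mono r" and "AE x in M. Cauchy (\<lambda>i. s (r i) x)"
    using cauchy_L1_AE_cauchy_subseq[of M s, OF s] cauchy unfolding real_norm_def by metis
  define f where "f x = lim (\<lambda>i. s (r i) x)" for x
  have sm[measurable]: "s n \<in> borel_measurable M" for n
    using s by auto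
  have fm[measurable]: "f \<in> borel_measurable M"
    unfolding f_def by measurable
  have lim: "AE x in M. (\<lambda>i. s (r i) x) \<longlonglongrightarrow> f x"
    using \<open>AE x in M. Cauchy (\<lambda>i. s (r i) x)\<close>
    by eventually_elim (simp add: f_def Cauchy_convergent_iff convergent_LIMSEQ_iff)
  \<comment> \<open>Integrability of \<open>f\<close> is not known yet, so the estimate is stated
    with the nonnegative integral.\<close>
  have fatou: "\<exists>N. \<forall>m\<ge>N. (\<integral>\<^sup>+x. ennreal \<bar>s m x - f x\<bar> \<partial>M) \<le> ennreal e" if e: "e > 0" for e
  proof -
    obtain N where N: "\<forall>i\<ge>N. \<forall>j\<ge>N. (\<integral>x. \<bar>s i x - s j x\<bar> \<partial>M) < e"
      using cauchy[OF e] by blast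
    have "(\<integral>\<^sup>+x. ennreal \<bar>s m x - f x\<bar> \<partial>M) \<le> ennreal e" if "m \<ge> N" for m
    proof -
      have "AE x in M. ennreal \<bar>s m x - f x\<bar> = liminf (\<lambda>i. ennreal \<bar>s m x - s (r i) x\<bar>)"
        using lim
      proof eventually_elim
        case (elim x)
        then have "(\<lambda>i. ennreal \<bar>s m x - s (r i) x\<bar>) \<longlonglongrightarrow> ennreal \<bar>s m x - f x\<bar>"
          by (intro tendsto_intros)
        then show ?case
          by (rule lim_imp_Liminf[OF sequentially_bot, symmetric])
      qed
      then have "(\<integral>\<^sup>+x. ennreal \<bar>s m x - f x\<bar> \<partial>M)
          = (\<integral>\<^sup>+x. liminf (\<lambda>i. ennreal \<bar>s m x - s (r i) x\<bar>) \<partial>M)"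
        by (rule nn_integral_cong_AE)
      also have "\<dots> \<le> liminf (\<lambda>i. \<integral>\<^sup>+x. ennreal \<bar>s m x - s (r i) x\<bar> \<partial>M)"
        by (intro nn_integral_liminf) measurable
      also have "\<dots> \<le> liminf (\<lambda>i. ennreal e)"
      proof (intro Liminf_mono)
        show "\<forall>\<^sub>F i in sequentially. (\<integral>\<^sup>+x. ennreal \<bar>s m x - s (r i) x\<bar> \<partial>M) \<le> ennreal e"
          using eventually_ge_at_top[of N]
        proof eventually_elim
          case (elim i)
          then have "r i \<ge> N"
            using strict_mono_imp_increasing[OF r, of i] by linarith
          moreover have "(\<integral>\<^sup>+x. ennreal \<bar>s m x - s (r i) x\<bar> \<partial>M)
              = ennreal (\<integral>x. \<bar>s m x - s (r i) x\<bar> \<partial>M)"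
            using s by (intro nn_integral_eq_integral) auto
          ultimately show ?case
            using N \<open>m \<ge> N\<close> by (simp add: ennreal_leI less_imp_le)
        qed
      qed
      finally show ?thesis
        by (simp add: Liminf_const)
    qed
    then show ?thesis by blast
  qed
  \<comment> \<open>A single finite distance makes \<open>s N - f\<close> integrable, and hence
    \<open>f\<close>.\<close>
  obtain N where "(\<integral>\<^sup>+x. ennreal \<bar>s N x - f x\<bar> \<partial>M) \<le> ennreal 1"
    using fatou[of 1] by auto
  then have "integrable M (\<lambda>x. s N x - f x)"
    by (intro integrableI_bounded) (auto simp: order_le_less_trans)
  from Bochner_Integration.integrable_diff[OF s[of N] this] have f: "integrable M f"
    by simp
  have "(\<lambda>n. \<integral>x. \<bar>s n x - f x\<bar> \<partial>M) \<longlonglongrightarrow> 0"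
  proof (rule LIMSEQ_I)
    fix e :: real assume "e > 0"
    then obtain N where N: "\<forall>m\<ge>N. (\<integral>\<^sup>+x. ennreal \<bar>s m x - f x\<bar> \<partial>M) \<le> ennreal (e / 2)"
      using fatou[of "e / 2"] by auto
    have "(\<integral>x. \<bar>s m x - f x\<bar> \<partial>M) \<le> e / 2" if "m \<ge> N" for m
    proof -
      have "(\<integral>\<^sup>+x. ennreal \<bar>s m x - f x\<bar> \<partial>M) = ennreal (\<integral>x. \<bar>s m x - f x\<bar> \<partial>M)"
        using s f by (intro nn_integral_eq_integral) auto
      with N that \<open>e > 0\<close> show ?thesis by (metis ennreal_le_iff half_gt_zero less_imp_le)
    qed
    with \<open>e > 0\<close> show "\<exists>N. \<forall>n\<ge>N. norm ((\<integral>x. \<bar>s n x - f x\<bar> \<partial>M) - 0) < e"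
      by (intro exI[of _ N]) force
  qed
  with f that show ?thesis by blast
qed

lemma mcomplete_L1: "Metric_space.mcomplete (vcarrier (L1 M)) (norm_dist (L1 M))"
proof -
  interpret Metric_space "vcarrier (L1 M)" "norm_dist (L1 M)"
    by (rule Metric_space_L1)
  show ?thesis
    unfolding mcomplete_def
  proof (intro strip)
    fix \<sigma> assume \<sigma>: "MCauchy \<sigma>"
    have "\<exists>f. integrable M f \<and> \<sigma> n = L1_class M f" for n
    proof -
      have "\<sigma> n \<in> vcarrier (L1 M)"
        using \<sigma> by (simp add: MCauchy_def image_subset_iff)
      then show ?thesis
        by (auto simp only: L1_vcarrier)
    qed
    then obtain s where s: "\<And>n. integrable M (s n)" "\<And>n. \<sigma> n = L1_class M (s n)"
      by metis
    have cauchy: "\<exists>N. \<forall>i\<ge>N. \<forall>j\<ge>N. (\<integral>x. \<bar>s i x - s j x\<bar> \<partial>M) < e" if "e > 0" for e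
    proof -
      have "\<exists>N. \<forall>i j. N \<le> i \<longrightarrow> N \<le> j \<longrightarrow> norm_dist (L1 M) (\<sigma> i) (\<sigma> j) < e"
        using \<sigma> that by (simp add: MCauchy_def)
      then show ?thesis
        by (simp only: s(2) norm_dist_L1[OF s(1) s(1)]) blast
    qed
    obtain f where "integrable M f" "(\<lambda>n. \<integral>x. \<bar>s n x - f x\<bar> \<partial>M) \<longlonglongrightarrow> 0"
      by (rule L1_limit_exists[OF s(1) cauchy])
    then have "limitin mtopology \<sigma> (L1_class M f) sequentially"
      unfolding limitin_metric_dist_null using s by (simp add: norm_dist_L1 L1_vcarrier)
    then show "\<exists>X. limitin mtopology \<sigma> X sequentially" ..
  qed
qed

section \<open>A criterion for finite dimension\<close>

text \<open>Induction on the number of functionals, for all subspaces at once: the kernel of the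
  last functional in \<open>S\<close> needs one functional fewer, and at most one further generator
  recovers \<open>S\<close>. The functionals act on representatives; \<open>cong\<close> makes them
  well defined on classes.\<close>

lemma finite_dimensional_if_kernel_trivial:
  fixes \<phi> :: "nat \<Rightarrow> ('a \<Rightarrow> real) \<Rightarrow> real"
  assumes add: "\<And>i f g. integrable M f \<Longrightarrow> integrable M g \<Longrightarrow> \<phi> i (\<lambda>x. f x + g x) = \<phi> i f + \<phi> i g"
    and scale: "\<And>i c f. integrable M f \<Longrightarrow> \<phi> i (\<lambda>x. c * f x) = c * \<phi> i f"
    and cong: "\<And>i f g. (f, g) \<in> ae_rel M \<Longrightarrow> \<phi> i f = \<phi> i g"
    and "linear_subspace (L1 M) S"
    and "\<And>f. integrable M f \<Longrightarrow> L1_class M f \<in> S \<Longrightarrow> (\<forall>i<n. \<phi> i f = 0) \<Longrightarrow> AE x in M. f x = 0"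
  shows "finite_dimensional (L1 M) S"
  using assms(4,5)
proof (induction n arbitrary: S)
  case (0 S)
  have "S \<subseteq> {vzero (L1 M)}"
  proof
    fix X assume "X \<in> S"
    moreover from this obtain f where "integrable M f" "X = L1_class M f"
      using "0.prems"(1) unfolding linear_subspace_def L1_vcarrier by blast
    ultimately show "X \<in> {vzero (L1 M)}"
      using "0.prems"(2)[of f] by (simp add: L1_vzero L1_class_eq_iff)
  qed
  \<comment> \<open>Every linear subspace contains zero, so the zero subspace is the hull of the
    empty set.\<close>
  then have "linear_subspace (L1 M) hull {} = S"
    using "0.prems"(1) by (intro hull_unique) (auto simp: linear_subspace_def)
  then show ?case
    unfolding finite_dimensional_def by (intro exI[of _ "{}"]) simp
next
  case (Suc n S)
  note S = \<open>linear_subspace (L1 M) S\<close>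
  show ?case
  proof (cases "\<exists>v. integrable M v \<and> L1_class M v \<in> S \<and> \<phi> n v \<noteq> 0")
    case False
    with Suc.prems show ?thesis
      by (intro Suc.IH) (auto simp: less_Suc_eq)
  next
    case True
    then obtain v where v: "integrable M v" "L1_class M v \<in> S" "\<phi> n v \<noteq> 0"
      by blast
    define K where "K = {L1_class M f |f. integrable M f \<and> L1_class M f \<in> S \<and> \<phi> n f = 0}"
    have K_iff: "L1_class M f \<in> K \<longleftrightarrow> L1_class M f \<in> S \<and> \<phi> n f = 0" if "integrable M f" for f
    proof
      assume "L1_class M f \<in> K"
      then obtain g where g: "integrable M g" "L1_class M f = L1_class M g"
          "L1_class M g \<in> S" "\<phi> n g = 0"
        unfolding K_def by blast
      then have "(f, g) \<in> ae_rel M"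
        using that L1_class_eq_iff[of M f g] by (simp add: ae_rel_def)
      with g show "L1_class M f \<in> S \<and> \<phi> n f = 0"
        using cong[of f g n] by simp
    qed (use that in \<open>auto simp: K_def\<close>)
    have K: "linear_subspace (L1 M) K"
      unfolding linear_subspace_def
    proof (intro conjI ballI allI)
      show "K \<subseteq> vcarrier (L1 M)"
        by (auto simp: K_def L1_vcarrier)
      have "\<phi> n (\<lambda>x. 0) = 0"
        using scale[of "\<lambda>x. 0" n 0] by simp
      then show "vzero (L1 M) \<in> K"
        using S K_iff[of "\<lambda>x. 0"] by (simp add: L1_vzero linear_subspace_def)
    next
      fix X Y assume "X \<in> K" "Y \<in> K"
      then obtain f g where f: "integrable M f" "X = L1_class M f" "X \<in> S" "\<phi> n f = 0"
        and g: "integrable M g" "Y = L1_class M g" "Y \<in> S" "\<phi> n g = 0"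
        unfolding K_def by blast
      have "vadd (L1 M) X Y \<in> S"
        using S f(3) g(3) by (simp add: linear_subspace_def)
      then show "vadd (L1 M) X Y \<in> K"
        using f g K_iff[of "\<lambda>x. f x + g x"] by (simp add: L1_vadd add)
    next
      fix c X assume "X \<in> K"
      then obtain f where f: "integrable M f" "X = L1_class M f" "X \<in> S" "\<phi> n f = 0"
        unfolding K_def by blast
      have "vscale (L1 M) c X \<in> S"
        using S f(3) by (simp add: linear_subspace_def)
      then show "vscale (L1 M) c X \<in> K"
        using f K_iff[of "\<lambda>x. c * f x"] by (simp add: L1_vscale scale)
    qed
    have "finite_dimensional (L1 M) K"
      using Suc.prems(2) by (intro Suc.IH[OF K]) (auto simp: K_iff less_Suc_eq)
    then obtain F where F: "finite F" "F \<subseteq> K" "linear_subspace (L1 M) hull F = K"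
      unfolding finite_dimensional_def by blast
    have "linear_subspace (L1 M) hull (insert (L1_class M v) F) = S"
    proof (rule hull_unique)
      show "insert (L1_class M v) F \<subseteq> S"
        using F(2) v(2) by (auto simp: K_def)
    next
      fix T assume T: "insert (L1_class M v) F \<subseteq> T" "linear_subspace (L1 M) T"
      then have "K \<subseteq> T"
        using F(3) hull_minimal[of F T "linear_subspace (L1 M)"] by simp
      show "S \<subseteq> T"
      proof
        fix X assume X: "X \<in> S"
        then obtain f where f: "integrable M f" "X = L1_class M f"
          using S unfolding linear_subspace_def L1_vcarrier by blast
        \<comment> \<open>This \<open>c\<close> makes \<open>g = f - c v\<close> lie in the kernel
          of \<open>\<phi> n\<close>, so that \<open>f\<close> is an element of \<open>K\<close>
          plus a multiple of \<open>v\<close>.\<close>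
        define c where "c = \<phi> n f / \<phi> n v"
        define g where "g = (\<lambda>x. f x + (- c) * v x)"
        have g: "integrable M g"
          unfolding g_def using f v by auto
        have "\<phi> n g = \<phi> n f + (- c) * \<phi> n v"
          unfolding g_def using f(1) v(1) by (simp only: add scale integrable_mult_right)
        then have "\<phi> n g = 0"
          using v(3) by (simp add: c_def)
        moreover have "L1_class M g = vadd (L1 M) X (vscale (L1 M) (- c) (L1_class M v))"
          unfolding g_def f(2) using f(1) v(1) by (simp add: L1_vadd L1_vscale)
        then have "L1_class M g \<in> S"
          using S X v(2) unfolding linear_subspace_def by simp
        ultimately have "L1_class M g \<in> T"
          using \<open>K \<subseteq> T\<close> K_iff[OF g] by blast
        moreover have "X = vadd (L1 M) (L1_class M g) (vscale (L1 M) c (L1_class M v))"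
          using f v(1) g by (simp add: L1_vadd L1_vscale) (simp add: g_def)
        ultimately show "X \<in> T"
          using T unfolding linear_subspace_def by simp
      qed
    qed (rule S)
    then show ?thesis
      unfolding finite_dimensional_def using F v(2)
      by (intro exI[of _ "insert (L1_class M v) F"]) (auto simp: K_def)
  qed
qed

section \<open>The mass of a function on a measurable set\<close>

lemma set_integrable_subset_integrable:
  fixes f :: "'a \<Rightarrow> real"
  assumes "integrable M f" "A \<in> sets M"
  shows "set_integrable M A f"
  unfolding set_integrable_def by (rule integrable_mult_indicator[OF assms(2,1)])

lemma set_integral_eq_0_iff_AE:
  fixes u :: "'a \<Rightarrow> real"
  assumes "integrable M u" "A \<in> sets M" "AE x in M. x \<in> A \<longrightarrow> 0 \<le> u x"
  shows "(LINT x:A|M. u x) = 0 \<longleftrightarrow> (AE x in M. x \<in> A \<longrightarrow> u x = 0)"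
proof -
  have "(LINT x:A|M. u x) = 0 \<longleftrightarrow> (AE x in M. indicator A x *\<^sub>R u x = 0)"
    unfolding set_lebesgue_integral_def
    using assms(3) by (intro integral_nonneg_eq_0_iff_AE integrable_mult_indicator assms)
      (auto elim!: eventually_mono simp: indicator_def)
  also have "\<dots> \<longleftrightarrow> (AE x in M. x \<in> A \<longrightarrow> u x = 0)"
    by (intro AE_cong) (auto simp: indicator_def)
  finally show ?thesis .
qed

lemma set_integral_abs_pos_iff:
  fixes f :: "'a \<Rightarrow> real"
  assumes "integrable M f" "A \<in> sets M"
  shows "0 < (LINT x:A|M. \<bar>f x\<bar>) \<longleftrightarrow> \<not> (AE x in M. x \<in> A \<longrightarrow> f x = 0)"
proof -
  have "0 \<le> (LINT x:A|M. \<bar>f x\<bar>)"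
    unfolding set_lebesgue_integral_def by (intro integral_nonneg_AE) auto
  then show ?thesis
    using set_integral_eq_0_iff_AE[of M "\<lambda>x. \<bar>f x\<bar>" A] assms by (auto simp: less_le)
qed

lemma set_integral_abs_le:
  fixes f :: "'a \<Rightarrow> real"
  assumes "integrable M f" "A \<in> sets M"
  shows "(LINT x:A|M. \<bar>f x\<bar>) \<le> (\<integral>x. \<bar>f x\<bar> \<partial>M)"
  unfolding set_lebesgue_integral_def using assms
  by (intro integral_mono integrable_mult_indicator) (auto simp: indicator_def)

lemma set_integral_abs_le_add:
  fixes f g :: "'a \<Rightarrow> real"
  assumes "integrable M f" "integrable M g" "A \<in> sets M"
  shows "(LINT x:A|M. \<bar>f x\<bar>) \<le> (LINT x:A|M. \<bar>g x\<bar>) + (\<integral>x. \<bar>f x - g x\<bar> \<partial>M)"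
proof -
  have "(LINT x:A|M. \<bar>f x\<bar>) \<le> (LINT x:A|M. \<bar>g x\<bar> + \<bar>f x - g x\<bar>)"
    unfolding set_lebesgue_integral_def using assms
    by (intro integral_mono integrable_mult_indicator) (auto simp: indicator_def)
  also have "\<dots> = (LINT x:A|M. \<bar>g x\<bar>) + (LINT x:A|M. \<bar>f x - g x\<bar>)"
    using assms by (intro set_integral_add set_integrable_subset_integrable) auto
  also have "(LINT x:A|M. \<bar>f x - g x\<bar>) \<le> (\<integral>x. \<bar>f x - g x\<bar> \<partial>M)"
    using assms by (intro set_integral_abs_le) auto
  finally show ?thesis by simp
qed

section \<open>Disjoint sets carrying mass\<close>

text \<open>For integrable \<open>f\<close>, the negation says that the finite measure with density
  \<open>\<bar>f\<bar>\<close> is concentrated on fewer than \<open>n\<close> atoms. The case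
  \<open>n = 0\<close> always holds and starts the induction in \<open>pieces_dense\<close>.\<close>

definition pieces :: "'a measure \<Rightarrow> nat \<Rightarrow> ('a \<Rightarrow> real) \<Rightarrow> bool" where
  "pieces M n f \<longleftrightarrow> (\<exists>E. (\<forall>i<n. E i \<in> sets M \<and> 0 < (LINT x:E i|M. \<bar>f x\<bar>)) \<and>
     disjoint_family_on E {..<n})"

lemma pieces_Suc:
  assumes "\<And>i. i < n \<Longrightarrow> E i \<in> sets M" "\<And>i. i < n \<Longrightarrow> 0 < (LINT x:E i|M. \<bar>f x\<bar>)"
    and "disjoint_family_on E {..<n}"
    and "A \<in> sets M" "0 < (LINT x:A|M. \<bar>f x\<bar>)" "\<And>i. i < n \<Longrightarrow> E i \<inter> A = {}"
  shows "pieces M (Suc n) f"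
  unfolding pieces_def
proof (intro exI[of _ "E(n := A)"] conjI)
  show "disjoint_family_on (E(n := A)) {..<Suc n}"
    using assms(3,6) unfolding disjoint_family_on_def by (auto simp: less_Suc_eq) blast+
qed (use assms in \<open>auto simp: less_Suc_eq\<close>)

text \<open>By \<open>set_integral_abs_le_add\<close>, the same sets work for \<open>g\<close> once
  the distance is below the least of the masses. At distance 0 this also shows that the choice of
  representative does not matter.\<close>

lemma pieces_open:
  assumes "integrable M f" "pieces M n f"
  obtains r where "0 < r"
    "\<And>g. integrable M g \<Longrightarrow> (\<integral>x. \<bar>f x - g x\<bar> \<partial>M) < r \<Longrightarrow> pieces M n g"
proof -
  obtain E where E: "\<And>i. i < n \<Longrightarrow> E i \<in> sets M" "\<And>i. i < n \<Longrightarrow> 0 < (LINT x:E i|M. \<bar>f x\<bar>)"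
    "disjoint_family_on E {..<n}"
    using assms(2) unfolding pieces_def by blast
  \<comment> \<open>The inserted 1 keeps the minimum meaningful for \<open>n = 0\<close>.\<close>
  define r where "r = Min (insert 1 ((\<lambda>i. LINT x:E i|M. \<bar>f x\<bar>) ` {..<n}))"
  have "0 < r"
    unfolding r_def using E(2) by (subst Min_gr_iff) auto
  moreover have "pieces M n g" if g: "integrable M g" "(\<integral>x. \<bar>f x - g x\<bar> \<partial>M) < r" for g
  proof -
    have "0 < (LINT x:E i|M. \<bar>g x\<bar>)" if "i < n" for i
    proof -
      have "r \<le> (LINT x:E i|M. \<bar>f x\<bar>)"
        unfolding r_def using that by (intro Min_le) auto
      with set_integral_abs_le_add[OF assms(1) g(1) E(1)[OF that]] g(2) show ?thesis
        by linarith
    qed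
    with E show ?thesis
      unfolding pieces_def by blast
  qed
  ultimately show ?thesis
    using that by blast
qed

section \<open>SSD-points have only finitely many pieces\<close>

lemma SSD_point_L1_mass_gap:
  assumes f: "integrable M f" and ssd: "SSD_point (L1 M) (L1_class M f)"
  obtains c where "0 < c"
    "\<And>E. E \<in> sets M \<Longrightarrow> 0 < (LINT x:E|M. \<bar>f x\<bar>) \<Longrightarrow> c \<le> (LINT x:E|M. \<bar>f x\<bar>)"
proof -
  define q where "q t H = (vnorm (L1 M) (vadd (L1 M) (L1_class M f) (vscale (L1 M) t H))
    - vnorm (L1 M) (L1_class M f)) / t" for t H
  obtain l where "uniform_limit (unit_ball (L1 M)) q l (at_right 0)"
    using ssd unfolding SSD_point_def q_def by blast
  then have "\<forall>\<^sub>F t in at_right 0. \<forall>H\<in>unit_ball (L1 M). dist (q t H) (l H) < 1 / 4"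
    by (rule uniform_limitD) simp
  then obtain b where b: "b > 0"
      "\<And>t H. 0 < t \<Longrightarrow> t < b \<Longrightarrow> H \<in> unit_ball (L1 M) \<Longrightarrow> dist (q t H) (l H) < 1 / 4"
    by (auto simp: eventually_at_right_field)
  \<comment> \<open>If the mass is below \<open>b / 8\<close>, both test values \<open>J\<close> and
    \<open>4 * J\<close> lie in the range \<open>0 < t < b\<close> where the uniform estimate
    holds.\<close>
  have "b / 8 \<le> (LINT x:E|M. \<bar>f x\<bar>)" if E: "E \<in> sets M" "0 < (LINT x:E|M. \<bar>f x\<bar>)" for E
  proof (rule ccontr)
    define J where "J = (LINT x:E|M. \<bar>f x\<bar>)"
    define e where "e = (\<lambda>x. indicator E x * \<bar>f x\<bar>)"
    assume "\<not> ?thesis"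
    then have J: "0 < J" "4 * J < b"
      using E b(1) by (auto simp: J_def)
    have e: "integrable M e" "(\<integral>x. e x \<partial>M) = J"
      using f E(1) integrable_mult_indicator[of E M "\<lambda>x. \<bar>f x\<bar>"]
      by (auto simp: e_def J_def set_lebesgue_integral_def)
    define h where "h = (\<lambda>x. - (indicator E x * f x) / J)"
    have h: "integrable M h"
      unfolding h_def using f E(1) integrable_mult_indicator[of E M f] by auto
    define H where "H = L1_class M h"
    have "(\<integral>x. \<bar>h x\<bar> \<partial>M) = (\<integral>x. e x / J \<partial>M)"
      using J by (intro Bochner_Integration.integral_cong) (auto simp: h_def e_def abs_mult)
    then have H: "H \<in> unit_ball (L1 M)"
      using h e J by (auto simp: unit_ball_def H_def L1_vnorm L1_vcarrier)
    \<comment> \<open>Moving along \<open>h\<close> multiplies \<open>f\<close> by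
      \<open>1 - t / J\<close> on \<open>E\<close> and leaves it unchanged elsewhere.\<close>
    have q: "q t H = J * (\<bar>1 - t / J\<bar> - 1) / t" for t
    proof -
      have "(\<integral>x. \<bar>f x + t * h x\<bar> \<partial>M) = (\<integral>x. \<bar>f x\<bar> + (\<bar>1 - t / J\<bar> - 1) * e x \<partial>M)"
      proof (intro Bochner_Integration.integral_cong refl)
        fix x
        have "f x + t * h x = f x * (1 - t / J)" if "x \<in> E"
          using that by (simp add: h_def algebra_simps)
        then show "\<bar>f x + t * h x\<bar> = \<bar>f x\<bar> + (\<bar>1 - t / J\<bar> - 1) * e x"
          by (cases "x \<in> E") (simp only: abs_mult, simp_all add: h_def e_def algebra_simps)
      qed
      also have "\<dots> = (\<integral>x. \<bar>f x\<bar> \<partial>M) + (\<bar>1 - t / J\<bar> - 1) * J"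
        using f e by (subst Bochner_Integration.integral_add) auto
      finally show ?thesis
        using f h by (simp add: q_def H_def L1_vnorm L1_vadd L1_vscale mult.commute)
    qed
    have "dist (q J H) (l H) < 1 / 4" "dist (q (4 * J) H) (l H) < 1 / 4"
      using b(2)[OF _ _ H, of J] b(2)[OF _ _ H, of "4 * J"] J by linarith+
    moreover have "q J H = - 1" "q (4 * J) H = 1 / 2"
      using J by (auto simp: q)
    \<comment> \<open>The value \<open>l H\<close> would be within \<open>1 / 4\<close> of both
      \<open>-1\<close> and \<open>1 / 2\<close>, which are \<open>3 / 2\<close> apart.\<close>
    ultimately show False
      unfolding dist_real_def by linarith
  qed
  with b(1) that[of "b / 8"] show ?thesis by auto
qed

text \<open>With the gap \<open>c\<close>, \<open>n\<close> disjoint pieces have total mass at least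
  \<open>n * c\<close>, which exceeds the norm of \<open>f\<close> for large
  \<open>n\<close>.\<close>

lemma SSD_point_L1_pieces_bounded:
  assumes f: "integrable M f" and ssd: "SSD_point (L1 M) (L1_class M f)"
  shows "\<exists>n. \<not> pieces M n f"
proof -
  obtain c where c: "0 < c"
    "\<And>E. E \<in> sets M \<Longrightarrow> 0 < (LINT x:E|M. \<bar>f x\<bar>) \<Longrightarrow> c \<le> (LINT x:E|M. \<bar>f x\<bar>)"
    using SSD_point_L1_mass_gap[OF assms] by blast
  obtain n where n: "(\<integral>x. \<bar>f x\<bar> \<partial>M) < real n * c"
    using reals_Archimedean3[OF c(1)] by blast
  have "\<not> pieces M n f"
  proof
    assume "pieces M n f"
    then obtain E where E: "\<And>i. i < n \<Longrightarrow> E i \<in> sets M"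
      "\<And>i. i < n \<Longrightarrow> 0 < (LINT x:E i|M. \<bar>f x\<bar>)" "disjoint_family_on E {..<n}"
      unfolding pieces_def by blast
    have "real n * c = (\<Sum>i<n. c)" by simp
    also have "\<dots> \<le> (\<Sum>i<n. LINT x:E i|M. \<bar>f x\<bar>)"
      using E c(2) by (intro sum_mono) auto
    also have "\<dots> = (LINT x:(\<Union>i<n. E i)|M. \<bar>f x\<bar>)"
      using E f by (intro set_integral_finite_Union[symmetric] set_integrable_subset_integrable) auto
    also have "\<dots> \<le> (\<integral>x. \<bar>f x\<bar> \<partial>M)"
      using E f by (intro set_integral_abs_le) auto
    finally show False using n by simp
  qed
  then show ?thesis ..
qed

section \<open>Density of functions with many pieces in an infinite dimensional subspace\<close>

text \<open>Maximality of \<open>n\<close> makes each \<open>E i\<close> an atom of the measure with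
  density \<open>\<bar>f\<bar>\<close>, and \<open>f\<close> vanishes off these sets. If every
  element of \<open>B\<close> vanished where \<open>f\<close> does, it would have constant sign on
  each \<open>E i\<close>, so its \<open>n\<close> integrals over these sets would detect whether it
  is zero.\<close>

lemma exists_direction_off_support:
  assumes B: "linear_subspace (L1 M) B" "\<not> finite_dimensional (L1 M) B"
    and f: "integrable M f"
    and pieces: "pieces M n f" "\<not> pieces M (Suc n) f"
  obtains h where "integrable M h" "L1_class M h \<in> B"
    "0 < (LINT x:{x \<in> space M. f x = 0}|M. \<bar>h x\<bar>)"
proof -
  have [measurable]: "f \<in> borel_measurable M" using f by auto
  obtain E where E: "\<And>i. i < n \<Longrightarrow> E i \<in> sets M" "\<And>i. i < n \<Longrightarrow> 0 < (LINT x:E i|M. \<bar>f x\<bar>)"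
    "disjoint_family_on E {..<n}"
    using pieces(1) unfolding pieces_def by blast
  \<comment> \<open>Otherwise the complement of the \<open>E i\<close> would be a further
    piece.\<close>
  have off: "AE x in M. x \<in> space M - (\<Union>i<n. E i) \<longrightarrow> f x = 0"
  proof -
    have D: "space M - (\<Union>i<n. E i) \<in> sets M"
      using E(1) by auto
    moreover have "E i \<inter> (space M - (\<Union>i<n. E i)) = {}" if "i < n" for i
      using that by auto
    ultimately have "\<not> 0 < (LINT x:(space M - (\<Union>i<n. E i))|M. \<bar>f x\<bar>)"
      using pieces(2) pieces_Suc[OF E D] by blast
    then show ?thesis
      using set_integral_abs_pos_iff[OF f D] by simp
  qed
  \<comment> \<open>Otherwise the two parts of \<open>E i\<close> would replace it and give
    \<open>n + 1\<close> pieces.\<close>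
  have split: "(AE x in M. x \<in> E i \<inter> P \<longrightarrow> f x = 0) \<or> (AE x in M. x \<in> E i - P \<longrightarrow> f x = 0)"
    if i: "i < n" and P: "P \<in> sets M" for i P
  proof (rule ccontr)
    assume *: "\<not> ?thesis"
    have s: "E i \<inter> P \<in> sets M" "E i - P \<in> sets M"
      using E(1)[OF i] P by auto
    have p: "0 < (LINT x:E i \<inter> P|M. \<bar>f x\<bar>)" "0 < (LINT x:E i - P|M. \<bar>f x\<bar>)"
      using * set_integral_abs_pos_iff[OF f s(1)] set_integral_abs_pos_iff[OF f s(2)] by auto
    have "pieces M (Suc n) f"
    proof (rule pieces_Suc[where E = "E(i := E i \<inter> P)" and A = "E i - P"])
      show "disjoint_family_on (E(i := E i \<inter> P)) {..<n}"
        using E(3) i by (auto simp: disjoint_family_on_def)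
      show "(E(i := E i \<inter> P)) j \<inter> (E i - P) = {}" if "j < n" for j
        using E(3) i that by (auto simp: disjoint_family_on_def)
    qed (use E p s in \<open>auto split: if_splits\<close>)
    with pieces(2) show False by contradiction
  qed
  have "\<exists>h. integrable M h \<and> L1_class M h \<in> B \<and> 0 < (LINT x:{x \<in> space M. f x = 0}|M. \<bar>h x\<bar>)"
  proof (rule ccontr)
    assume none: "\<not> ?thesis"
    have zero: "AE x in M. f x = 0 \<longrightarrow> h x = 0" if "integrable M h" "L1_class M h \<in> B" for h
    proof -
      have "AE x in M. x \<in> {x \<in> space M. f x = 0} \<longrightarrow> h x = 0"
        using none that set_integral_abs_pos_iff[OF that(1), of "{x \<in> space M. f x = 0}"] by auto
      with AE_space show ?thesis
        by eventually_elim auto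
    qed
    \<comment> \<open>Nothing is known about \<open>E i\<close> for \<open>i \<ge> n\<close>, not
      even measurability; the value 0 there makes linearity and compatibility hold for every
      \<open>i\<close>.\<close>
    define \<phi> where "\<phi> i h = (if i < n then (LINT x:E i|M. h x) else 0)" for i and h :: "'a \<Rightarrow> real"
    have "finite_dimensional (L1 M) B"
    proof (rule finite_dimensional_if_kernel_trivial[where \<phi> = \<phi> and n = n])
      fix i and g h :: "'a \<Rightarrow> real"
      show "\<phi> i (\<lambda>x. g x + h x) = \<phi> i g + \<phi> i h" if "integrable M g" "integrable M h"
        using that E(1)[of i] by (auto simp: \<phi>_def intro!: set_integral_add set_integrable_subset_integrable)
      show "\<phi> i (\<lambda>x. c * h x) = c * \<phi> i h" for c
        by (simp add: \<phi>_def)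
      show "\<phi> i g = \<phi> i h" if "(g, h) \<in> ae_rel M"
        using that E(1)[of i] unfolding \<phi>_def set_lebesgue_integral_def ae_rel_def
        by (auto intro!: integral_cong_AE)
    next
      fix h assume h: "integrable M h" "L1_class M h \<in> B" "\<forall>i<n. \<phi> i h = 0"
      have [measurable]: "h \<in> borel_measurable M" using h by auto
      have "AE x in M. x \<in> E i \<longrightarrow> h x = 0" if i: "i < n" for i
      proof -
        have 0: "(LINT x:E i|M. h x) = 0"
          using h(3) i by (auto simp: \<phi>_def)
        have P: "{x \<in> space M. h x > 0} \<in> sets M" by measurable
        \<comment> \<open>Where \<open>f\<close> vanishes so does \<open>h\<close>. Hence either the
          positive part of \<open>h\<close> is null on \<open>E i\<close> or \<open>h\<close> is
          nonnegative there, and the zero integral forces \<open>h = 0\<close> on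
          \<open>E i\<close>.\<close>
        from split[OF i P] show ?thesis
        proof
          assume "AE x in M. x \<in> E i \<inter> {x \<in> space M. h x > 0} \<longrightarrow> f x = 0"
          with zero[OF h(1,2)] AE_space have "AE x in M. x \<in> E i \<longrightarrow> 0 \<le> - h x"
            by eventually_elim force
          moreover have "(LINT x:E i|M. - h x) = 0"
            using 0 by (simp add: set_lebesgue_integral_def)
          ultimately show ?thesis
            using set_integral_eq_0_iff_AE[of M "\<lambda>x. - h x" "E i"] h(1) E(1)[OF i] by simp
        next
          assume "AE x in M. x \<in> E i - {x \<in> space M. h x > 0} \<longrightarrow> f x = 0"
          with zero[OF h(1,2)] AE_space have "AE x in M. x \<in> E i \<longrightarrow> 0 \<le> h x"
            by eventually_elim force
          then show ?thesis
            using set_integral_eq_0_iff_AE[of M h "E i"] h(1) E(1)[OF i] 0 by simp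
        qed
      qed
      then have "AE x in M. \<forall>i\<in>{..<n}. x \<in> E i \<longrightarrow> h x = 0"
        by (intro AE_finite_allI) auto
      with off zero[OF h(1,2)] AE_space show "AE x in M. h x = 0"
        by eventually_elim auto
    qed (rule B(1))
    with B(2) show False ..
  qed
  with that show ?thesis by blast
qed

text \<open>On the zero set of \<open>f\<close> the perturbed function is \<open>t * h\<close>,
  which gives the new piece. The old pieces survive as soon as \<open>t\<close> times the norm of
  \<open>h\<close> is below each of their masses.\<close>

lemma pieces_Suc_perturb:
  assumes f: "integrable M f" and h: "integrable M h" and pieces: "pieces M n f"
    and pos: "0 < (LINT x:{x \<in> space M. f x = 0}|M. \<bar>h x\<bar>)"
  shows "\<forall>\<^sub>F t in at_right 0. pieces M (Suc n) (\<lambda>x. f x + t * h x)"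
proof -
  have [measurable]: "f \<in> borel_measurable M" using f by auto
  let ?Z = "{x \<in> space M. f x = 0}"
  obtain E where E: "\<And>i. i < n \<Longrightarrow> E i \<in> sets M" "\<And>i. i < n \<Longrightarrow> 0 < (LINT x:E i|M. \<bar>f x\<bar>)"
    "disjoint_family_on E {..<n}"
    using pieces unfolding pieces_def by blast
  have ev: "\<forall>\<^sub>F t in at_right 0. t * (\<integral>x. \<bar>h x\<bar> \<partial>M) < (LINT x:E i|M. \<bar>f x\<bar>)" if "i < n" for i
  proof -
    have "((\<lambda>t. t * (\<integral>x. \<bar>h x\<bar> \<partial>M)) \<longlongrightarrow> 0 * (\<integral>x. \<bar>h x\<bar> \<partial>M)) (at_right 0)"
      by (intro tendsto_intros)
    then show ?thesis
      using E(2)[OF that] by (auto dest: order_tendstoD(2))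
  qed
  then have "\<forall>\<^sub>F t in at_right 0. \<forall>i\<in>{..<n}. t * (\<integral>x. \<bar>h x\<bar> \<partial>M) < (LINT x:E i|M. \<bar>f x\<bar>)"
    by (intro eventually_ball_finite) auto
  with eventually_at_right_less[of 0] show ?thesis
  proof eventually_elim
    case (elim t)
    let ?g = "\<lambda>x. f x + t * h x"
    have g: "integrable M ?g" using f h by auto
    show ?case
    \<comment> \<open>Removing the zero set costs no mass of \<open>f\<close> and makes the old
      pieces disjoint from the new one.\<close>
    proof (rule pieces_Suc[where E = "\<lambda>i. E i - ?Z" and A = ?Z])
      fix i assume i: "i < n"
      show s: "E i - ?Z \<in> sets M"
        using E(1)[OF i] by auto
      have "(LINT x:E i - ?Z|M. \<bar>f x\<bar>) = (LINT x:E i|M. \<bar>f x\<bar>)"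
        unfolding set_lebesgue_integral_def
        by (intro Bochner_Integration.integral_cong) (auto simp: indicator_def)
      moreover have "(\<integral>x. \<bar>f x - ?g x\<bar> \<partial>M) = t * (\<integral>x. \<bar>h x\<bar> \<partial>M)"
        using elim(1) by (simp add: abs_mult)
      ultimately show "0 < (LINT x:E i - ?Z|M. \<bar>?g x\<bar>)"
        using set_integral_abs_le_add[OF f g s] elim(2) i by force
      show "(E i - ?Z) \<inter> ?Z = {}" by blast
    next
      show "disjoint_family_on (\<lambda>i. E i - ?Z) {..<n}"
        using E(3) by (auto simp: disjoint_family_on_def)
      have "(LINT x:?Z|M. \<bar>?g x\<bar>) = (LINT x:?Z|M. t * \<bar>h x\<bar>)"
        unfolding set_lebesgue_integral_def using elim(1)
        by (intro Bochner_Integration.integral_cong) (auto simp: indicator_def abs_mult)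
      then show "0 < (LINT x:?Z|M. \<bar>?g x\<bar>)"
        using pos elim(1) by simp
    qed measurable
  qed
qed

text \<open>Induction on \<open>n\<close>: half of \<open>e\<close> goes to the approximation with
  \<open>n\<close> pieces, half to the perturbation that adds one more when \<open>n\<close> is
  maximal for \<open>g\<close>.\<close>

lemma pieces_dense:
  assumes B: "linear_subspace (L1 M) B" "\<not> finite_dimensional (L1 M) B"
    and f: "integrable M f" "L1_class M f \<in> B" and "0 < e"
  shows "\<exists>g. integrable M g \<and> L1_class M g \<in> B \<and> (\<integral>x. \<bar>f x - g x\<bar> \<partial>M) < e \<and> pieces M n g"
  using \<open>0 < e\<close>
proof (induction n arbitrary: e)
  case 0
  with f show ?case
    by (intro exI[of _ f]) (auto simp: pieces_def disjoint_family_on_def)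
next
  case (Suc n)
  obtain g where g: "integrable M g" "L1_class M g \<in> B" "(\<integral>x. \<bar>f x - g x\<bar> \<partial>M) < e / 2" "pieces M n g"
    using Suc.IH[of "e / 2"] Suc.prems by auto
  show ?case
  proof (cases "pieces M (Suc n) g")
    case True
    with g Suc.prems show ?thesis
      by (intro exI[of _ g]) auto
  next
    case False
    obtain h where h: "integrable M h" "L1_class M h \<in> B"
        "0 < (LINT x:{x \<in> space M. g x = 0}|M. \<bar>h x\<bar>)"
      using exists_direction_off_support[OF B g(1,4) False] by blast
    have "((\<lambda>t. t * (\<integral>x. \<bar>h x\<bar> \<partial>M)) \<longlongrightarrow> 0 * (\<integral>x. \<bar>h x\<bar> \<partial>M)) (at_right 0)"
      by (intro tendsto_intros)
    then have "\<forall>\<^sub>F t in at_right 0. t * (\<integral>x. \<bar>h x\<bar> \<partial>M) < e / 2"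
      using Suc.prems by (intro order_tendstoD(2)) auto
    then have "\<forall>\<^sub>F t in at_right 0. 0 < t \<and> t * (\<integral>x. \<bar>h x\<bar> \<partial>M) < e / 2 \<and>
        pieces M (Suc n) (\<lambda>x. g x + t * h x)"
      using eventually_at_right_less[of 0] pieces_Suc_perturb[OF g(1) h(1) g(4) h(3)]
      by eventually_elim auto
    then obtain t :: real where t: "0 < t" "t * (\<integral>x. \<bar>h x\<bar> \<partial>M) < e / 2"
        "pieces M (Suc n) (\<lambda>x. g x + t * h x)"
      using eventually_happens[of _ "at_right (0::real)"] by auto
    have "(\<integral>x. \<bar>f x - (g x + t * h x)\<bar> \<partial>M) \<le> (\<integral>x. \<bar>f x - g x\<bar> + t * \<bar>h x\<bar> \<partial>M)"
    proof (intro integral_mono)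
      fix x show "\<bar>f x - (g x + t * h x)\<bar> \<le> \<bar>f x - g x\<bar> + t * \<bar>h x\<bar>"
        using abs_triangle_ineq4[of "f x - g x" "t * h x"] t(1) by (simp add: abs_mult algebra_simps)
    qed (use f g h in auto)
    also have "\<dots> = (\<integral>x. \<bar>f x - g x\<bar> \<partial>M) + t * (\<integral>x. \<bar>h x\<bar> \<partial>M)"
      using f g h by (subst Bochner_Integration.integral_add) auto
    finally have "(\<integral>x. \<bar>f x - (g x + t * h x)\<bar> \<partial>M) < e"
      using g(3) t(2) by linarith
    moreover have "L1_class M (\<lambda>x. g x + t * h x) = vadd (L1 M) (L1_class M g) (vscale (L1 M) t (L1_class M h))"
      using g h by (simp add: L1_vadd L1_vscale)
    then have "L1_class M (\<lambda>x. g x + t * h x) \<in> B"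
      using B(1) g(2) h(2) unfolding linear_subspace_def by simp
    moreover have "integrable M (\<lambda>x. g x + t * h x)"
      using g h by auto
    ultimately show ?thesis
      using t(3) by blast
  qed
qed

section \<open>The Baire category argument\<close>

theorem corollary2p13:
  fixes \<mu> :: "'a measure" and B :: "('a \<Rightarrow> real) set set"
  assumes "isometric_to_dual (L1 \<mu>) TYPE('x::banach)"
    and "closed_linear_subspace (L1 \<mu>) B"
    and "\<forall>f\<in>B. SSD_point (L1 \<mu>) f"
  shows "finite_dimensional (L1 \<mu>) B"
proof (rule ccontr)
  assume infdim: "\<not> finite_dimensional (L1 \<mu>) B"
  have B: "linear_subspace (L1 \<mu>) B" "closedin (norm_topology (L1 \<mu>)) B"
    using assms(2) by (auto simp: closed_linear_subspace_def)
  have sub: "B \<subseteq> vcarrier (L1 \<mu>)" "vzero (L1 \<mu>) \<in> B"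
    using B(1) by (auto simp: linear_subspace_def)
  interpret L: Metric_space "vcarrier (L1 \<mu>)" "norm_dist (L1 \<mu>)"
    by (rule Metric_space_L1)
  interpret S: Submetric "vcarrier (L1 \<mu>)" "norm_dist (L1 \<mu>)" B
    by unfold_locales (rule sub(1))
  \<comment> \<open>Closedness of \<open>B\<close> enters here: it makes \<open>B\<close> itself a
    complete metric space.\<close>
  have complete: "S.sub.mcomplete"
    using B(2) unfolding norm_topology_def
    by (rule S.closedin_mcomplete_imp_mcomplete) (rule mcomplete_L1)
  have rep: "\<exists>f. integrable \<mu> f \<and> X = L1_class \<mu> f" if "X \<in> B" for X
    using that sub(1) by (auto simp: L1_vcarrier)
  \<comment> \<open>Membership asks for some representative with \<open>n\<close> pieces, possibly a
    different one for each \<open>n\<close>.\<close>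
  define U where "U n = {L1_class \<mu> f |f. integrable \<mu> f \<and> L1_class \<mu> f \<in> B \<and> pieces \<mu> n f}" for n
  have U_open: "openin S.sub.mtopology (U n)" for n
    unfolding S.sub.openin_mtopology
  proof (intro conjI allI impI)
    show "U n \<subseteq> B" by (auto simp: U_def)
    fix X assume "X \<in> U n"
    then obtain f where f: "integrable \<mu> f" "X = L1_class \<mu> f" "pieces \<mu> n f"
      by (auto simp: U_def)
    obtain r where r: "0 < r"
      "\<And>g. integrable \<mu> g \<Longrightarrow> (\<integral>x. \<bar>f x - g x\<bar> \<partial>\<mu>) < r \<Longrightarrow> pieces \<mu> n g"
      using pieces_open[OF f(1,3)] by blast
    have "S.sub.mball X r \<subseteq> U n"
    proof
      fix Y assume "Y \<in> S.sub.mball X r"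
      then have Y: "Y \<in> B" "norm_dist (L1 \<mu>) X Y < r" by auto
      from rep[OF Y(1)] obtain g where "integrable \<mu> g" "Y = L1_class \<mu> g" by blast
      with Y f r(2)[of g] show "Y \<in> U n"
        by (auto simp: norm_dist_L1 U_def)
    qed
    with r(1) show "\<exists>r>0. S.sub.mball X r \<subseteq> U n" by blast
  qed
  have U_dense: "S.sub.mtopology closure_of U n = B" for n
    unfolding S.sub.metric_closure_of
  proof (intro subset_antisym subsetI CollectI conjI allI impI)
    fix X and e :: real assume X: "X \<in> B" and "0 < e"
    from rep[OF X] obtain f where f: "integrable \<mu> f" "X = L1_class \<mu> f" by blast
    with pieces_dense[OF B(1) infdim, of f e n] X \<open>0 < e\<close> obtain g
      where g: "integrable \<mu> g" "L1_class \<mu> g \<in> B" "(\<integral>x. \<bar>f x - g x\<bar> \<partial>\<mu>) < e" "pieces \<mu> n g"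
      by blast
    then have "L1_class \<mu> g \<in> U n" "L1_class \<mu> g \<in> S.sub.mball X e"
      using f X by (auto simp: U_def norm_dist_L1)
    then show "\<exists>Y\<in>U n. Y \<in> S.sub.mball X e" by blast
  qed auto
  have "S.sub.mtopology closure_of \<Inter>(range U) = B"
    using U_open U_dense by (intro S.sub.metric_Baire_category complete) auto
  \<comment> \<open>The closure of the intersection contains zero, so the intersection is
    nonempty.\<close>
  with sub(2) have "\<Inter>(range U) \<noteq> {}"
    by (metis closure_of_empty empty_iff)
  then obtain X where X: "\<And>n. X \<in> U n" by blast
  then have "X \<in> B" by (auto simp: U_def)
  with rep obtain f where f: "integrable \<mu> f" "X = L1_class \<mu> f" by blast
  \<comment> \<open>All representatives are at distance 0 from each other, so
    \<open>pieces_open\<close> transfers each property to the single function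
    \<open>f\<close>.\<close>
  have "pieces \<mu> n f" for n
  proof -
    obtain g where g: "integrable \<mu> g" "X = L1_class \<mu> g" "pieces \<mu> n g"
      using X[of n] by (auto simp: U_def)
    then have "AE x in \<mu>. \<bar>g x - f x\<bar> = 0"
      using f L1_class_eq_iff[of \<mu> g f] by auto
    then have "(\<integral>x. \<bar>g x - f x\<bar> \<partial>\<mu>) = 0"
      by (rule integral_eq_zero_AE)
    then show ?thesis
      using pieces_open[OF g(1,3)] f(1) by metis
  qed
  moreover have "SSD_point (L1 \<mu>) (L1_class \<mu> f)"
    using assms(3) \<open>X \<in> B\<close> f(2) by simp
  ultimately show False
    using SSD_point_L1_pieces_bounded[OF f(1)] by blast
qed

end
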